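(* Let $B_n$ be the braid group on $n$ strands with Artin generators $\sigma_i$, $1\le i\le n-1$, and let $\mathbb{Z}[a^{\pm1},b^{\pm1},c^{\pm1},d^{\pm1}]$ be the ring of Laurent polynomials in four variables over $\mathbb{Z}$. The map $$\Psi:B_n\to GL_n(\mathbb{Z}[a^{\pm1},b^{\pm1},c^{\pm1},d^{\pm1}]),\qquad \Psi(\sigma_i):=I_{i-1}\oplus\begin{pmatrix}a&b\\ c&d\end{pmatrix}\oplus I_{n-i-1},\quad 1\le i\le n-1,$$ defines a non-trivial representation of $B_n$ into $GL_n(\mathbb{Z}[a^{\pm1},b^{\pm1},c^{\pm1},d^{\pm1}])$ if and only if one of the following cases occurs: Case 1: $d=0$, $c=\frac{1-a}{b}$ and $a\neq 1$, which results in the representation $$\Psi:B_n\to GL_n(\mathbb{Z}[a^{\pm1},b^{\pm1}]),\qquad \Psi(\sigma_i)=I_{i-1}\oplus\begin{pmatrix}a&b\\ \frac{1-a}{b}&0\end{pmatrix}\oplus I_{n-i-1};$$ Case 2: $a=0$, $c=\frac{1-d}{b}$ and $d\neq 1$, which results in the representation $$\Psi:B_n\to GL_n(\mathbb{Z}[d^{\pm1},b^{\pm1}]),\qquad \Psi(\sigma_i)=I_{i-1}\oplus\begin{pmatrix}0&b\\ \frac{1-d}{b}&d\end{pmatrix}\oplus I_{n-i-1};$$ Case 3: $a=d=0$, $b\neq 0$ and $c\neq 0$, which results in the representation $$\Psi:B_n\to GL_n(\mathbb{Z}[c^{\pm1},b^{\pm1}]),\qquad \Psi(\sigma_i)=I_{i-1}\oplus\begin{pmatrix}0&b\\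 c&0\end{pmatrix}\oplus I_{n-i-1}.$$
   Context: The braid group $B_n$ is generated by $\sigma_1,\dots,\sigma_{n-1}$ subject to $\sigma_i\sigma_{i+1}\sigma_i=\sigma_{i+1}\sigma_i\sigma_{i+1}$ for $1\le i\le n-2$ and $\sigma_i\sigma_j=\sigma_j\sigma_i$ for $|i-j|\ge 2$. $I_k$ denotes the $k\times k$ identity matrix and $\oplus$ the block-diagonal sum of matrices. The conditions in the cases are conditions imposed on the parameters $a,b,c,d$ (the rings being written in terms of the remaining parameters). The map "defines a representation" if the matrices $\Psi(\sigma_i)$ are invertible and satisfy the defining relations of $B_n$; the trivial representation is the one sending every $\sigma_i$ to the identity matrix.
   Formalization: Assumes n ≥ 3 (for n = 2 there are no relations and "only if" fails). In Cases 1 and 2 the entries lie in the stated ring, but GL_n is taken after also inverting 1−a (resp. 1−d), as the determinant a−1 (resp. d−1) is not a unit there. *)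

theory Defs
  imports "Jordan_Normal_Form.VS_Connect" "HOL-Algebra.Generated_Rings"
begin

text \<open>
  The ring of Laurent polynomials with integer coefficients in the elements of S, evaluated in an
  ambient field: for \<open>S = {a, b}\<close> it is \<open>\<int>[a\<^sup>\<plusminus>\<^sup>1, b\<^sup>\<plusminus>\<^sup>1]\<close>. If the elements of S are algebraically
  independent over the rationals, this is the Laurent polynomial ring in these indeterminates.
  Since \<open>inverse 0 = 0\<close>, a parameter that has been specialised to 0 contributes nothing and only
  the nonzero parameters are inverted.
\<close>

definition laurent_ring :: "'k::field set \<Rightarrow> 'k set" where
  "laurent_ring S = generate_ring class_ring (S \<union> inverse ` S)"

text \<open>The general linear group over a subring R: the inverse must have entries in R as well.\<close>

definition GL :: "nat \<Rightarrow> 'k::field set \<Rightarrow> 'k mat set" where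
  "GL n R = {A \<in> carrier_mat n n. elements_mat A \<subseteq> R \<and>
     (\<exists>B \<in> carrier_mat n n. elements_mat B \<subseteq> R \<and> inverts_mat A B \<and> inverts_mat B A)}"

text \<open>
  A family \<open>\<rho>\<close> of matrices, where \<open>\<rho> i\<close> is the image of the Artin generator \<open>\<sigma>\<^sub>i\<close> for
  \<open>1 \<le> i \<le> n - 1\<close>; values at other indices are irrelevant.
\<close>

definition braid_rep :: "nat \<Rightarrow> 'k::field set \<Rightarrow> (nat \<Rightarrow> 'k mat) \<Rightarrow> bool" where
  "braid_rep n R \<rho> \<longleftrightarrow>
     (\<forall>i \<in> {1..n - 1}. \<rho> i \<in> GL n R) \<and>
     (\<forall>i \<in> {1..n - 2}. \<rho> i * \<rho> (i + 1) * \<rho> i = \<rho> (i + 1) * \<rho> i * \<rho> (i + 1)) \<and>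
     (\<forall>i \<in> {1..n - 1}. \<forall>j \<in> {1..n - 1}.
        \<bar>int i - int j\<bar> \<ge> 2 \<longrightarrow> \<rho> i * \<rho> j = \<rho> j * \<rho> i)"

definition trivial_rep :: "nat \<Rightarrow> (nat \<Rightarrow> 'k::field mat) \<Rightarrow> bool" where
  "trivial_rep n \<rho> \<longleftrightarrow> (\<forall>i \<in> {1..n - 1}. \<rho> i = 1\<^sub>m n)"

definition nontrivial_braid_rep :: "nat \<Rightarrow> 'k::field set \<Rightarrow> (nat \<Rightarrow> 'k mat) \<Rightarrow> bool" where
  "nontrivial_braid_rep n R \<rho> \<longleftrightarrow> braid_rep n R \<rho> \<and> \<not> trivial_rep n \<rho>"

definition mat2 :: "'k::field \<Rightarrow> 'k \<Rightarrow> 'k \<Rightarrow> 'k \<Rightarrow> 'k mat" where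
  "mat2 a b c d = mat_of_rows_list 2 [[a, b], [c, d]]"

definition Psi :: "nat \<Rightarrow> 'k::field mat \<Rightarrow> nat \<Rightarrow> 'k mat" where
  "Psi n M i = diag_block_mat [1\<^sub>m (i - 1), M, 1\<^sub>m (n - i - 1)]"

end

theory Submission
  imports Defs
begin

text \<open>
  Left multiplication by \<open>Psi n M i\<close> acts on a matrix by recombining the two rows \<open>i - 1\<close> and \<open>i\<close>
  (counted from 0), so all the relations can be compared entry by entry. Far commutativity is
  automatic, and for \<open>M = (a, b; c, d)\<close> the braid relation amounts to
  \<open>a b d = a c d = a d (a - d) = 0\<close>, \<open>a (a + b c) = a\<close>, \<open>d (d + b c) = d\<close>.
  If \<open>a\<close> and \<open>d\<close> are both nonzero, these force \<open>M = 1\<close>; otherwise \<open>a d = 0\<close>, and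
  invertibility becomes \<open>b c \<noteq> 0\<close>.
\<close>

section \<open>Closure properties of the coefficient rings\<close>

lemma laurent_ring_1: "1 \<in> laurent_ring S"
  and laurent_ring_uminus: "x \<in> laurent_ring S \<Longrightarrow> - x \<in> laurent_ring S"
  and laurent_ring_add: "x \<in> laurent_ring S \<Longrightarrow> y \<in> laurent_ring S \<Longrightarrow> x + y \<in> laurent_ring S"
  and laurent_ring_mult: "x \<in> laurent_ring S \<Longrightarrow> y \<in> laurent_ring S \<Longrightarrow> x * y \<in> laurent_ring S"
  and laurent_ring_incl: "x \<in> S \<Longrightarrow> x \<in> laurent_ring S"
  and laurent_ring_inverse: "x \<in> S \<Longrightarrow> inverse x \<in> laurent_ring S"
  for S :: "'k::field set"
  unfolding laurent_ring_def
  using generate_ring.intros[where R = "class_ring :: 'k ring", unfolded class_ring_simps]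
  by auto

lemma laurent_ring_0: "0 \<in> laurent_ring S"
  using laurent_ring_add[OF laurent_ring_1 laurent_ring_uminus[OF laurent_ring_1]] by simp

section \<open>Entries of the matrices and of their products\<close>

lemma Psi_carrier:
  assumes "1 \<le> i" "i < n"
  shows "Psi n (mat2 a b c d) i \<in> carrier_mat n n"
  using assms by (auto simp: Psi_def mat2_def mat_of_rows_list_def Let_def)

lemma Psi_dim:
  assumes "1 \<le> i" "i < n"
  shows "dim_row (Psi n (mat2 a b c d) i) = n" "dim_col (Psi n (mat2 a b c d) i) = n"
  using Psi_carrier[OF assms, of a b c d] by auto

lemma Psi_index:
  assumes "1 \<le> i" "i < n" "r < n" "s < n"
  shows "Psi n (mat2 a b c d) i $$ (r, s) =
    (if r = i - 1 then (if s = i - 1 then a else if s = i then b else 0)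
     else if r = i then (if s = i - 1 then c else if s = i then d else 0)
     else if r = s then 1 else 0)"
proof -
  obtain k where k: "i = Suc k"
    using assms(1) by (cases i) auto
  have M: "mat2 a b c d \<in> carrier_mat 2 2" "mat2 a b c d $$ (0, 0) = a" "mat2 a b c d $$ (0, 1) = b"
    "mat2 a b c d $$ (1, 0) = c" "mat2 a b c d $$ (1, 1) = d"
    by (auto simp: mat2_def mat_of_rows_list_def)
  \<comment> \<open>Relative to the rows and columns \<open>k\<close> and \<open>Suc k\<close> of
    the middle block, these cases locate the entry in the block-diagonal matrix.\<close>
  have "r < k \<or> r = k \<or> r = Suc k \<or> Suc k < r"
    "s < k \<or> s = k \<or> s = Suc k \<or> Suc k < s"
    by linarith+
  then show ?thesis
    using assms M
    by (elim disjE) (simp_all add: Psi_def k Suc_diff_le, auto)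
qed

lemma Psi_mult_index:
  assumes i: "1 \<le> i" "i < n" and X: "X \<in> carrier_mat n n" and rs: "r < n" "s < n"
  shows "(Psi n (mat2 a b c d) i * X) $$ (r, s) =
    (if r = i - 1 then a * X $$ (i - 1, s) + b * X $$ (i, s)
     else if r = i then c * X $$ (i - 1, s) + d * X $$ (i, s)
     else X $$ (r, s))"
proof -
  let ?P = "Psi n (mat2 a b c d) i"
  have "(?P * X) $$ (r, s) = (\<Sum>k = 0..<n. ?P $$ (r, k) * X $$ (k, s))"
    using Psi_carrier[OF i, of a b c d] X rs by (auto simp: scalar_prod_def)
  \<comment> \<open>Outside this index set, row \<open>r\<close> of \<open>?P\<close>
    vanishes.\<close>
  also have "\<dots> = (\<Sum>k \<in> (if r = i - 1 \<or> r = i then {i - 1, i} else {r}). ?P $$ (r, k) * X $$ (k, s))"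
    using i rs by (intro sum.mono_neutral_right) (auto simp: Psi_index split: if_splits)
  also have "\<dots> = (if r = i - 1 then a * X $$ (i - 1, s) + b * X $$ (i, s)
     else if r = i then c * X $$ (i - 1, s) + d * X $$ (i, s)
     else X $$ (r, s))"
    using i rs by (auto simp: Psi_index)
  finally show ?thesis .
qed

lemma Psi_mult_carrier:
  assumes "1 \<le> i" "i < n" "X \<in> carrier_mat n n"
  shows "Psi n (mat2 a b c d) i * X \<in> carrier_mat n n"
  using Psi_carrier[OF assms(1,2)] assms(3) by (rule mult_carrier_mat)

text \<open>These rules evaluate entries of products nested to the right. The competing rule
  \<open>index_mult_mat\<close>, which expands a product into scalar products, is removed wherever
  they are used on products.\<close>

lemmas Psi_simps = Psi_carrier Psi_dim Psi_index Psi_mult_index Psi_mult_carrier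

section \<open>Inversion, far commutativity and the braid relation\<close>

lemma Psi_mult_eq_one:
  assumes "1 \<le> i" "i < n"
    and "a * a' + b * c' = 1" "a * b' + b * d' = 0" "c * a' + d * c' = 0" "c * b' + d * d' = 1"
  shows "Psi n (mat2 a b c d) i * Psi n (mat2 a' b' c' d') i = 1\<^sub>m n"
proof (rule eq_matI)
  fix r s
  assume "r < dim_row (1\<^sub>m n :: 'a mat)" "s < dim_col (1\<^sub>m n :: 'a mat)"
  then show "(Psi n (mat2 a b c d) i * Psi n (mat2 a' b' c' d') i) $$ (r, s) = 1\<^sub>m n $$ (r, s)"
    using assms by (auto simp: Psi_simps simp del: index_mult_mat)
qed (use assms in \<open>simp_all add: Psi_dim\<close>)

lemma Psi_commute:
  assumes i: "1 \<le> i" "i < n" and j: "1 \<le> j" "j < n" and far: "i + 2 \<le> j"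
  shows "Psi n (mat2 a b c d) i * Psi n (mat2 a' b' c' d') j =
    Psi n (mat2 a' b' c' d') j * Psi n (mat2 a b c d) i"
proof (rule eq_matI)
  let ?P = "Psi n (mat2 a b c d) i" and ?Q = "Psi n (mat2 a' b' c' d') j"
  show "dim_row (?P * ?Q) = dim_row (?Q * ?P)" "dim_col (?P * ?Q) = dim_col (?Q * ?P)"
    using i j by (simp_all add: Psi_dim)
  fix r s
  assume "r < dim_row (?Q * ?P)" "s < dim_col (?Q * ?P)"
  then have rs: "r < n" "s < n"
    using i j by (simp_all add: Psi_dim)
  obtain k where k: "i = Suc k"
    using i by (cases i) auto
  obtain l where l: "j = Suc l"
    using j by (cases j) auto
  \<comment> \<open>By \<open>far\<close>, the row pairs \<open>{k, Suc k}\<close> and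
    \<open>{l, Suc l}\<close> are disjoint, so the two row operations do not interact.\<close>
  consider "r = k" | "r = Suc k" | "r = l" | "r = Suc l" | "r \<notin> {k, Suc k, l, Suc l}"
    by auto
  then show "(?P * ?Q) $$ (r, s) = (?Q * ?P) $$ (r, s)"
    using i j far rs by cases (simp_all add: k l Psi_simps del: index_mult_mat)
qed

lemma Psi_braid:
  assumes i: "1 \<le> i" "i + 1 < n"
    and ad: "a * d = 0" and eqs: "a * (a + b * c) = a" "d * (d + b * c) = d"
  shows "Psi n (mat2 a b c d) i * (Psi n (mat2 a b c d) (i + 1) * Psi n (mat2 a b c d) i) =
    Psi n (mat2 a b c d) (i + 1) * (Psi n (mat2 a b c d) i * Psi n (mat2 a b c d) (i + 1))"
proof (rule eq_matI)
  let ?P = "Psi n (mat2 a b c d) i" and ?Q = "Psi n (mat2 a b c d) (i + 1)"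
  show "dim_row (?P * (?Q * ?P)) = dim_row (?Q * (?P * ?Q))"
    "dim_col (?P * (?Q * ?P)) = dim_col (?Q * (?P * ?Q))"
    using i by (simp_all add: Psi_dim)
  fix r s
  assume "r < dim_row (?Q * (?P * ?Q))" "s < dim_col (?Q * (?P * ?Q))"
  then have rs: "r < n" "s < n"
    using i by (simp_all add: Psi_dim)
  obtain k where k: "i = Suc k"
    using i by (cases i) auto
  \<comment> \<open>These are the conditions at the entries \<open>(k, k)\<close> and
    \<open>(k + 2, k + 2)\<close>, in the shape in which \<open>Psi_simps\<close> produces them. At
    every other entry the two sides agree up to a multiple of \<open>a * d\<close>.\<close>
  have eqs': "a * a + b * (a * c) = a" "c * (d * b) + d * d = d"
    using eqs by (simp_all add: algebra_simps)
  consider "r = k" | "r = Suc k" | "r = Suc (Suc k)" | "r \<notin> {k, Suc k, Suc (Suc k)}"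
    by auto
  then show "(?P * (?Q * ?P)) $$ (r, s) = (?Q * (?P * ?Q)) $$ (r, s)"
    using i rs
    by cases (simp_all add: k Psi_simps del: index_mult_mat, use ad eqs' in auto)
qed

section \<open>From the equations to a representation\<close>

lemma Psi_elements_subset:
  assumes "1 \<le> i" "i < n" "{0, 1, a, b, c, d} \<subseteq> R"
  shows "elements_mat (Psi n (mat2 a b c d) i) \<subseteq> R"
proof
  fix x
  assume "x \<in> elements_mat (Psi n (mat2 a b c d) i)"
  then obtain r s where "r < n" "s < n" "x = Psi n (mat2 a b c d) i $$ (r, s)"
    using Psi_carrier[OF assms(1,2), of a b c d] by (auto dest!: elements_matD)
  with assms show "x \<in> R"
    by (auto simp: Psi_index)
qed

lemma Psi_in_GL:
  assumes i: "1 \<le> i" "i < n" and ad: "a * d = 0" and "b \<noteq> 0" "c \<noteq> 0"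
    and R: "a \<in> laurent_ring S" "b \<in> laurent_ring S" "c \<in> laurent_ring S" "d \<in> laurent_ring S"
      "inverse b \<in> laurent_ring S" "inverse c \<in> laurent_ring S"
  shows "Psi n (mat2 a b c d) i \<in> GL n (laurent_ring S)"
proof -
  let ?P = "Psi n (mat2 a b c d) i"
  \<comment> \<open>The adjugate divided by the determinant, which is \<open>- b * c\<close> because
    \<open>a * d = 0\<close>. So only \<open>b\<close> and \<open>c\<close> have to be
    inverted.\<close>
  let ?a = "- d * (inverse b * inverse c)" and ?d = "- a * (inverse b * inverse c)"
  let ?Q = "Psi n (mat2 ?a (inverse c) (inverse b) ?d) i"
  have "?P * ?Q = 1\<^sub>m n" "?Q * ?P = 1\<^sub>m n"
    using assms by (auto intro!: Psi_mult_eq_one simp: field_simps)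
  moreover have "elements_mat ?P \<subseteq> laurent_ring S" "elements_mat ?Q \<subseteq> laurent_ring S"
    using i R
    by (intro Psi_elements_subset; simp add: laurent_ring_0 laurent_ring_1 laurent_ring_uminus
        laurent_ring_mult del: mult_minus_left)+
  ultimately show ?thesis
    using Psi_carrier[OF i] i unfolding GL_def inverts_mat_def
    by (auto simp: Psi_dim intro!: bexI[of _ ?Q])
qed

text \<open>The set \<open>S\<close> stays free because the theorem applies this over four different
  rings.\<close>

lemma nontrivial_braid_rep_PsiI:
  assumes n: "n \<ge> 3" and ad: "a * d = 0" and bc: "b \<noteq> 0" "c \<noteq> 0"
    and eqs: "a * (a + b * c) = a" "d * (d + b * c) = d"
    and R: "a \<in> laurent_ring S" "b \<in> laurent_ring S" "c \<in> laurent_ring S" "d \<in> laurent_ring S"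
      "inverse b \<in> laurent_ring S" "inverse c \<in> laurent_ring S"
  shows "nontrivial_braid_rep n (laurent_ring S) (Psi n (mat2 a b c d))"
  unfolding nontrivial_braid_rep_def braid_rep_def
proof (intro conjI ballI impI)
  let ?P = "Psi n (mat2 a b c d)"
  show "?P i \<in> GL n (laurent_ring S)" if "i \<in> {1..n - 1}" for i
    using that ad bc R by (intro Psi_in_GL) auto
  show "?P i * ?P (i + 1) * ?P i = ?P (i + 1) * ?P i * ?P (i + 1)" if "i \<in> {1..n - 2}" for i
  proof -
    have i: "1 \<le> i" "i < n" "i + 1 < n"
      using that n by auto
    then have car: "?P i \<in> carrier_mat n n" "?P (i + 1) \<in> carrier_mat n n"
      by (auto intro: Psi_carrier)
    have "?P i * (?P (i + 1) * ?P i) = ?P (i + 1) * (?P i * ?P (i + 1))"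
      using i(1,3) ad eqs by (rule Psi_braid)
    then show ?thesis
      by (simp only: assoc_mult_mat[OF car(1,2,1)] assoc_mult_mat[OF car(2,1,2)])
  qed
  show "?P i * ?P j = ?P j * ?P i"
    if "i \<in> {1..n - 1}" "j \<in> {1..n - 1}" "2 \<le> \<bar>int i - int j\<bar>" for i j
  proof (cases "i \<le> j")
    case True
    with that show ?thesis
      by (intro Psi_commute) auto
  next
    case False
    with that show ?thesis
      by (intro Psi_commute[symmetric]) auto
  qed
  show "\<not> trivial_rep n ?P"
  proof
    assume "trivial_rep n ?P"
    then have "?P 1 $$ (0, 1) = 1\<^sub>m n $$ (0, 1)"
      using n unfolding trivial_rep_def by auto
    then show False
      using n bc by (simp add: Psi_index)
  qed
qed

section \<open>From a representation to the equations\<close>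

lemma nontrivial_braid_rep_PsiD:
  assumes n: "n \<ge> 3" and rep: "nontrivial_braid_rep n R (Psi n (mat2 a b c d))"
  shows "a * d = 0" "b * c \<noteq> 0" "a * (a + b * c) = a" "d * (d + b * c) = d"
proof -
  let ?P = "Psi n (mat2 a b c d)"
  \<comment> \<open>As \<open>n \<ge> 3\<close>, there is a braid relation between the first two
    generators; its entries in rows 0 to 2 already give all the equations.\<close>
  have "1 \<in> {1..n - 1}" "1 \<in> {1..n - 2}"
    using n by auto
  then have "?P 1 \<in> GL n R" and "?P 1 * ?P (1 + 1) * ?P 1 = ?P (1 + 1) * ?P 1 * ?P (1 + 1)"
    using rep unfolding nontrivial_braid_rep_def braid_rep_def by blast+
  moreover have car: "?P 1 \<in> carrier_mat n n" "?P 2 \<in> carrier_mat n n"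
    using n by (auto intro!: Psi_carrier)
  ultimately have braid: "?P 1 * (?P 2 * ?P 1) = ?P 2 * (?P 1 * ?P 2)"
    by (simp only: one_add_one assoc_mult_mat[OF car(1,2,1)] assoc_mult_mat[OF car(2,1,2)])
  have entry: "(?P 1 * (?P 2 * ?P 1)) $$ (r, s) = (?P 2 * (?P 1 * ?P 2)) $$ (r, s)" for r s
    by (simp only: braid)
  show a: "a * (a + b * c) = a"
    using n entry[of 0 0] by (simp add: Psi_simps algebra_simps del: index_mult_mat)
  show d: "d * (d + b * c) = d"
    using n entry[of 2 2] by (simp add: Psi_simps algebra_simps del: index_mult_mat)
  have abd: "a * b * d = 0"
    using n entry[of 0 1] by (simp add: Psi_simps algebra_simps del: index_mult_mat)
  have acd: "a * c * d = 0"
    using n entry[of 1 0] by (simp add: Psi_simps algebra_simps del: index_mult_mat)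
  show ad: "a * d = 0"
  proof (rule ccontr)
    assume "a * d \<noteq> 0"
    \<comment> \<open>Cancelling in \<open>abd\<close> and \<open>acd\<close> gives
      \<open>b = c = 0\<close>; then \<open>a\<close> and \<open>d\<close> are nonzero
      idempotents.\<close>
    then have "a = 1" "b = 0" "c = 0" "d = 1"
      using a d abd acd by auto
    then have "?P i = 1\<^sub>m n" if "i \<in> {1..n - 1}" for i
      using that n by (intro eq_matI) (auto simp: Psi_index Psi_dim)
    with rep show False
      unfolding nontrivial_braid_rep_def trivial_rep_def by blast
  qed
  obtain B where B: "B \<in> carrier_mat n n" "?P 1 * B = 1\<^sub>m n"
    using \<open>?P 1 \<in> GL n R\<close> car unfolding GL_def inverts_mat_def by auto
  then have "(?P 1 * B) $$ (r, s) = 1\<^sub>m n $$ (r, s)" for r s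
    by simp
  \<comment> \<open>The first two rows of \<open>?P 1\<close> vanish beyond column 1, so the upper
    left corner of \<open>B\<close> is a right inverse of the 2x2 block.\<close>
  from this[of 0 0] this[of 0 1] this[of 1 0] this[of 1 1]
  have inverse: "a * B $$ (0, 0) + b * B $$ (1, 0) = 1" "a * B $$ (0, 1) + b * B $$ (1, 1) = 0"
    "c * B $$ (0, 0) + d * B $$ (1, 0) = 0" "c * B $$ (0, 1) + d * B $$ (1, 1) = 1"
    using n B by (simp_all add: Psi_simps del: index_mult_mat)
  \<comment> \<open>Multiplicativity of the 2x2 determinant: \<open>a * d - b * c\<close> is a unit,
    and \<open>a * d = 0\<close>.\<close>
  have "(a * d - b * c) * (B $$ (0, 0) * B $$ (1, 1) - B $$ (0, 1) * B $$ (1, 0)) =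
    (a * B $$ (0, 0) + b * B $$ (1, 0)) * (c * B $$ (0, 1) + d * B $$ (1, 1)) -
    (a * B $$ (0, 1) + b * B $$ (1, 1)) * (c * B $$ (0, 0) + d * B $$ (1, 0))"
    by (simp add: algebra_simps)
  also have "\<dots> = 1"
    unfolding inverse by simp
  finally have "(a * d - b * c) * (B $$ (0, 0) * B $$ (1, 1) - B $$ (0, 1) * B $$ (1, 0)) = 1" .
  with ad show "b * c \<noteq> 0"
    by auto
qed

text \<open>In the first two cases the blocks have determinant \<open>a - 1\<close> and
  \<open>d - 1\<close>. The entries lie in \<open>laurent_ring {a, b}\<close> or
  \<open>laurent_ring {d, b}\<close>, but the inverse matrices involve \<open>b / (1 - a)\<close> or
  \<open>b / (1 - d)\<close>; hence the extra generator \<open>1 - a\<close> or \<open>1 - d\<close>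
  in the ring of the representation.\<close>

theorem theorem3p1:
  fixes a b c d :: "'k::field" and n :: nat
  assumes "n \<ge> 3"
  shows
    "(nontrivial_braid_rep n (laurent_ring {a, b, c, d}) (Psi n (mat2 a b c d)) \<longleftrightarrow>
        (d = 0 \<and> b \<noteq> 0 \<and> c = (1 - a) / b \<and> a \<noteq> 1) \<or>
        (a = 0 \<and> b \<noteq> 0 \<and> c = (1 - d) / b \<and> d \<noteq> 1) \<or>
        (a = 0 \<and> d = 0 \<and> b \<noteq> 0 \<and> c \<noteq> 0))
     \<and> (d = 0 \<and> b \<noteq> 0 \<and> c = (1 - a) / b \<and> a \<noteq> 1 \<longrightarrow>
        (\<forall>i \<in> {1..n - 1}.
           Psi n (mat2 a b c d) i = Psi n (mat2 a b ((1 - a) / b) 0) i \<and>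
           elements_mat (Psi n (mat2 a b ((1 - a) / b) 0) i) \<subseteq> laurent_ring {a, b}) \<and>
        nontrivial_braid_rep n (laurent_ring {a, b, 1 - a}) (Psi n (mat2 a b ((1 - a) / b) 0)))
     \<and> (a = 0 \<and> b \<noteq> 0 \<and> c = (1 - d) / b \<and> d \<noteq> 1 \<longrightarrow>
        (\<forall>i \<in> {1..n - 1}.
           Psi n (mat2 a b c d) i = Psi n (mat2 0 b ((1 - d) / b) d) i \<and>
           elements_mat (Psi n (mat2 0 b ((1 - d) / b) d) i) \<subseteq> laurent_ring {d, b}) \<and>
        nontrivial_braid_rep n (laurent_ring {d, b, 1 - d}) (Psi n (mat2 0 b ((1 - d) / b) d)))
     \<and> (a = 0 \<and> d = 0 \<and> b \<noteq> 0 \<and> c \<noteq> 0 \<longrightarrow>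
        (\<forall>i \<in> {1..n - 1}. Psi n (mat2 a b c d) i = Psi n (mat2 0 b c 0) i) \<and>
        nontrivial_braid_rep n (laurent_ring {c, b}) (Psi n (mat2 0 b c 0)))"
proof (intro conjI impI)
  let ?rep = "\<lambda>S a b c d. nontrivial_braid_rep n (laurent_ring S) (Psi n (mat2 a b c d))"
  let ?case1 = "d = 0 \<and> b \<noteq> 0 \<and> c = (1 - a) / b \<and> a \<noteq> 1"
  let ?case2 = "a = 0 \<and> b \<noteq> 0 \<and> c = (1 - d) / b \<and> d \<noteq> 1"
  let ?case3 = "a = 0 \<and> d = 0 \<and> b \<noteq> 0 \<and> c \<noteq> 0"
  show "?rep {a, b, c, d} a b c d \<longleftrightarrow> ?case1 \<or> ?case2 \<or> ?case3"
  proof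
    assume "?rep {a, b, c, d} a b c d"
    note D = nontrivial_braid_rep_PsiD[OF assms this]
    \<comment> \<open>A nonzero \<open>a\<close> leads to the first case, a nonzero \<open>d\<close>
      to the second, and \<open>a = d = 0\<close> to the third; \<open>a \<noteq> 1\<close> and
      \<open>d \<noteq> 1\<close> come from \<open>b * c \<noteq> 0\<close>.\<close>
    have "a = 0 \<or> d = 0" "b \<noteq> 0" "c \<noteq> 0" "a = 0 \<or> b * c = 1 - a" "d = 0 \<or> b * c = 1 - d"
      using D by (auto simp: eq_diff_eq add.commute mult_cancel_left1 mult_cancel_left2)
    moreover have "c = x / b" if "b * c = x" for x
      using that \<open>b \<noteq> 0\<close> by auto
    ultimately show "?case1 \<or> ?case2 \<or> ?case3"
      by (metis divide_eq_0_iff right_minus_eq)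
  next
    assume "?case1 \<or> ?case2 \<or> ?case3"
    then have "a * d = 0" "b \<noteq> 0" "c \<noteq> 0" "a * (a + b * c) = a" "d * (d + b * c) = d"
      by (elim disjE; simp)+
    then show "?rep {a, b, c, d} a b c d"
      by (intro nontrivial_braid_rep_PsiI assms)
        (simp_all add: laurent_ring_incl laurent_ring_inverse)
  qed
  have diff: "1 - x \<in> laurent_ring S" if "x \<in> S" for x :: 'k and S
    using laurent_ring_add[OF laurent_ring_1 laurent_ring_uminus[OF laurent_ring_incl[OF that]]]
    by simp
  have frac: "(1 - x) / b \<in> laurent_ring S" if "x \<in> S" "b \<in> S" for x S
    using laurent_ring_mult[OF diff[OF that(1)] laurent_ring_inverse[OF that(2)]]
    by (simp add: field_simps)
  \<comment> \<open>The inverse is \<open>b * inverse (1 - x)\<close>, with \<open>1 - x\<close>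
    inverted as a generator.\<close>
  have inv: "inverse ((1 - x) / b) \<in> laurent_ring S" if "1 - x \<in> S" "b \<in> S" for x S
    using laurent_ring_mult[OF laurent_ring_incl[OF that(2)] laurent_ring_inverse[OF that(1)]]
    by (simp add: field_simps)
  {
    assume case1: ?case1
    show "\<forall>i \<in> {1..n - 1}. Psi n (mat2 a b c d) i = Psi n (mat2 a b ((1 - a) / b) 0) i \<and>
        elements_mat (Psi n (mat2 a b ((1 - a) / b) 0) i) \<subseteq> laurent_ring {a, b}"
      using case1 assms
      by (intro ballI conjI Psi_elements_subset)
        (simp_all add: laurent_ring_0 laurent_ring_1 laurent_ring_incl frac, linarith)
    \<comment> \<open>Without \<open>inverse_divide\<close> the inverse of the quotient keeps the
      form that \<open>inv\<close> matches.\<close>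
    show "?rep {a, b, 1 - a} a b ((1 - a) / b) 0"
      using case1
      by (intro nontrivial_braid_rep_PsiI assms)
        (simp_all add: laurent_ring_0 laurent_ring_incl laurent_ring_inverse frac inv
          del: inverse_divide)
  next
    assume case2: ?case2
    show "\<forall>i \<in> {1..n - 1}. Psi n (mat2 a b c d) i = Psi n (mat2 0 b ((1 - d) / b) d) i \<and>
        elements_mat (Psi n (mat2 0 b ((1 - d) / b) d) i) \<subseteq> laurent_ring {d, b}"
      using case2 assms
      by (intro ballI conjI Psi_elements_subset)
        (simp_all add: laurent_ring_0 laurent_ring_1 laurent_ring_incl frac, linarith)
    show "?rep {d, b, 1 - d} 0 b ((1 - d) / b) d"
      using case2
      by (intro nontrivial_braid_rep_PsiI assms)
        (simp_all add: laurent_ring_0 laurent_ring_incl laurent_ring_inverse frac inv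
          del: inverse_divide)
  next
    assume case3: ?case3
    then show "\<forall>i \<in> {1..n - 1}. Psi n (mat2 a b c d) i = Psi n (mat2 0 b c 0) i"
      by simp
    show "?rep {c, b} 0 b c 0"
      using case3
      by (intro nontrivial_braid_rep_PsiI assms)
        (simp_all add: laurent_ring_0 laurent_ring_incl laurent_ring_inverse)
  }
qed

end
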